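(* Let $\alpha\in(0,2)$ and let $\mu$ be a probability law on $\mathbb{R}$ (not necessarily symmetric) that is regularly varying with index $\alpha$. Let $p=p_n$ be a sequence of positive integers with $p_n\to\infty$ and $p_n=o(n^2)$ as $n\to\infty$. For each $n$ let $\boldsymbol{X}_1,\dots,\boldsymbol{X}_n$ be i.i.d. random vectors drawn from the $\alpha$-spherical distribution $\mu_{\alpha,p_n}$ on $\mathbb{S}^{p_n-1}$ associated with $\mu$. Then $$\max_{1\le i<j\le n}\left(\boldsymbol{X}_i^{\top}\boldsymbol{X}_j\right)\ \stackrel{\mathbb{P}}{\to}\ 1$$ as $n\to\infty$, where $\stackrel{\mathbb{P}}{\to}$ denotes convergence in probability.
   Context: $\mathbb{S}^{p-1}=\{x\in\mathbb{R}^p:\|x\|_2=1\}$. A probability law $\mu$ on $\mathbb{R}$ is regularly varying with index $\alpha\in(0,2)$ if, for $X\sim\mu$, $\mathbb{P}(|X|\ge x)\sim L(x)x^{-\alpha}$ as $x\to\infty$ for some slowly varying function $L$, i.e. $\lim_{x\to\infty}L(ax)/L(x)=1$ for all $a>0$. The $\alpha$-spherical distribution $\mu_{\alpha,p}$ associated with such a $\mu$ is the distribution on $\mathbb{S}^{p-1}$ of the random vector $$\left(\frac{X_1}{\sqrt{\sum_{k=1}^pX_k^2}},\dots,\frac{X_p}{\sqrt{\sum_{k=1}^pX_k^2}}\right),$$ where $X_1,\dots,X_p$ are i.i.d. with law $\mu$ (it being understood that this is a distribution supported on $\mathbb{S}^{p-1}$, i.e. the denominator is almost surely nonzero). *)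

theory Defs
  imports "HOL-Probability.Probability" "HOL-Library.Landau_Symbols"
begin

(* Only behaviour near infinity matters: the condition forces L to be nonzero there. *)
definition slowly_varying :: "(real \<Rightarrow> real) \<Rightarrow> bool" where
  "slowly_varying L \<longleftrightarrow> (\<forall>a>0. ((\<lambda>x. L (a * x) / L x) \<longlongrightarrow> 1) at_top)"

definition regularly_varying_law :: "real measure \<Rightarrow> real \<Rightarrow> bool" where
  "regularly_varying_law \<mu> \<alpha> \<longleftrightarrow>
     real_distribution \<mu> \<and> 0 < \<alpha> \<and> \<alpha> < 2 \<and>
     (\<exists>L. slowly_varying L \<and>
        (\<lambda>x. measure \<mu> {t. x \<le> \<bar>t\<bar>}) \<sim>[at_top] (\<lambda>x. L x * x powr (- \<alpha>)))"

(* Vectors in R^p are functions that are undefined outside {..<p}, so that p can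
   depend on n. The measure Rvec p is used only for its space and sigma-algebra. *)
abbreviation (input) Rvec :: "nat \<Rightarrow> (nat \<Rightarrow> real) measure" where
  "Rvec p \<equiv> Pi\<^sub>M {..<p} (\<lambda>_. borel)"

abbreviation (input) iid_vec :: "real measure \<Rightarrow> nat \<Rightarrow> (nat \<Rightarrow> real) measure" where
  "iid_vec \<mu> p \<equiv> Pi\<^sub>M {..<p} (\<lambda>_. \<mu>)"

definition inner_vec :: "nat \<Rightarrow> (nat \<Rightarrow> real) \<Rightarrow> (nat \<Rightarrow> real) \<Rightarrow> real" where
  "inner_vec p x y = (\<Sum>k<p. x k * y k)"

definition self_normalize :: "nat \<Rightarrow> (nat \<Rightarrow> real) \<Rightarrow> (nat \<Rightarrow> real)" where
  "self_normalize p x = (\<lambda>k\<in>{..<p}. x k / sqrt (\<Sum>j<p. (x j)\<^sup>2))"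

(* A law on R^p; it is carried by the unit sphere precisely under
   normalizer_nonzero, see AE_alpha_spherical_unit_norm. The index alpha enters
   only through mu. *)
definition alpha_spherical :: "real measure \<Rightarrow> nat \<Rightarrow> (nat \<Rightarrow> real) measure" where
  "alpha_spherical \<mu> p = distr (iid_vec \<mu> p) (Rvec p) (self_normalize p)"

definition normalizer_nonzero :: "real measure \<Rightarrow> nat \<Rightarrow> bool" where
  "normalizer_nonzero \<mu> p \<longleftrightarrow> (AE x in iid_vec \<mu> p. sqrt (\<Sum>j<p. (x j)\<^sup>2) \<noteq> 0)"

(* The probability space may change with n. *)
definition tendsto_in_prob ::
  "(nat \<Rightarrow> 'a measure) \<Rightarrow> (nat \<Rightarrow> 'a \<Rightarrow> real) \<Rightarrow> real \<Rightarrow> bool" where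
  "tendsto_in_prob M Z c \<longleftrightarrow>
     (\<forall>n. Z n \<in> borel_measurable (M n)) \<and>
     (\<forall>\<epsilon>>0. (\<lambda>n. measure (M n) {\<omega> \<in> space (M n). \<bar>Z n \<omega> - c\<bar> > \<epsilon>}) \<longlonglongrightarrow> 0)"

lemma measurable_self_normalize:
  assumes "real_distribution \<mu>"
  shows "self_normalize p \<in> measurable (iid_vec \<mu> p) (Rvec p)"
proof -
  interpret real_distribution \<mu> by fact
  show ?thesis
    unfolding self_normalize_def by measurable
qed

lemma AE_alpha_spherical_unit_norm:
  assumes "real_distribution \<mu>"
  shows "(AE x in alpha_spherical \<mu> p. sqrt (\<Sum>k<p. (x k)\<^sup>2) = 1) \<longleftrightarrow> normalizer_nonzero \<mu> p"
proof -
  have norm: "sqrt (\<Sum>k<p. (self_normalize p x k)\<^sup>2) = 1 \<longleftrightarrow> sqrt (\<Sum>j<p. (x j)\<^sup>2) \<noteq> 0" for x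
  proof -
    define s where "s = (\<Sum>j<p. (x j)\<^sup>2)"
    have "s \<ge> 0" by (simp add: s_def sum_nonneg)
    then have "(\<Sum>k<p. (self_normalize p x k)\<^sup>2) = (\<Sum>k<p. (x k)\<^sup>2 / s)"
      by (intro sum.cong) (auto simp: self_normalize_def power_divide s_def[symmetric])
    also have "\<dots> = s / s" unfolding s_def sum_divide_distrib ..
    finally show ?thesis by (simp add: s_def[symmetric])
  qed
  have "{x \<in> space (Rvec p). sqrt (\<Sum>k<p. (x k)\<^sup>2) = 1} \<in> sets (Rvec p)"
    by measurable
  then show ?thesis
    unfolding alpha_spherical_def normalizer_nonzero_def
    by (subst AE_distr_iff[OF measurable_self_normalize[OF assms]]) (simp_all only: norm)
qed

end

theory Submission
  imports Defs "HOL-Real_Asymp.Real_Asymp"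
begin

text \<open>
  A regularly varying law with index below two obeys the principle of a single big jump even for
  sums of squares: with probability bounded away from zero, one of \<open>p\<close> independent coordinates
  carries almost all of the squared Euclidean norm, because the second moment truncated at \<open>x\<close>
  is at most a constant times \<open>x\<^sup>2\<close> times the tail at \<open>x\<close> (lemma \<open>dyadic_karamata\<close>). After
  normalisation such a vector lies close to plus or minus a unit coordinate vector. For one of
  the two signs, each coordinate plays this part with probability at least \<open>c / p\<close> (lemma
  \<open>prob_dominated_by_lower_bound\<close>).

  Two sample vectors with the same dominating coordinate and sign have inner product close to 1
  (lemma \<open>inner_vec_dominated_by\<close>). Whether two such vectors exist is a birthday problem with
  \<open>p\<close> cells, each hit with probability at least \<open>c / p\<close>. Among \<open>n\<close> vectors the expected
  number of coincidences is at least of the order \<open>n\<^sup>2 / p\<close>, which tends to infinity, and the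
  second moment method (lemma \<open>birthday_collision_bound\<close>) yields a coincidence with probability
  tending to 1. The maximum never exceeds 1, since all vectors have unit length almost surely.
\<close>

section \<open>A birthday problem with unequal cells\<close>

text \<open>Second moment method for \<open>W\<close>, the number of triples \<open>(i, j, k)\<close> with \<open>X i\<close> and \<open>X j\<close>
  both in \<open>A k\<close>. Taking \<open>i\<close> and \<open>j\<close> from disjoint groups makes \<open>W\<close> a bilinear form
  \<open>\<Sum>k\<in>K. U I k * U J k\<close> in two independent vectors of counts, so its second moment follows
  from the moments of order two of one group. The mean of \<open>W\<close> is \<open>lam\<close>, its variance at most
  \<open>2 * lam * sqrt lam + lam\<close>, and Chebyshev's inequality bounds the probability of \<open>W = 0\<close>.\<close>

lemma (in prob_space) birthday_collision_bound:
  fixes X :: "'i \<Rightarrow> 'a \<Rightarrow> 'b" and A :: "'k \<Rightarrow> 'b set" and q :: "'k \<Rightarrow> real"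
  assumes indep: "indep_vars (\<lambda>_. N) X (I \<union> J)"
    and disj: "I \<inter> J = {}" and fin: "finite I" "finite J" and card: "card I = m" "card J = m"
    and finK: "finite K" and A: "\<And>k. k \<in> K \<Longrightarrow> A k \<in> sets N" "disjoint_family_on A K"
    and q: "\<And>i k. i \<in> I \<union> J \<Longrightarrow> k \<in> K \<Longrightarrow> prob {\<omega> \<in> space M. X i \<omega> \<in> A k} = q k"
    and lam: "lam = (real m)\<^sup>2 * (\<Sum>k\<in>K. (q k)\<^sup>2)" "0 < lam"
  shows "prob {\<omega> \<in> space M. \<forall>i\<in>I. \<forall>j\<in>J. \<forall>k\<in>K. \<not> (X i \<omega> \<in> A k \<and> X j \<omega> \<in> A k)}
    \<le> 2 / sqrt lam + 1 / lam"
proof -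
  define U :: "'i set \<Rightarrow> 'k \<Rightarrow> 'a \<Rightarrow> real"
    where "U B k \<omega> = (\<Sum>i\<in>B. indicator (A k) (X i \<omega>))" for B k \<omega>
  define W where "W \<omega> = (\<Sum>k\<in>K. U I k \<omega> * U J k \<omega>)" for \<omega>
  define S where "S = (\<Sum>k\<in>K. (q k)\<^sup>2)"
  have X [measurable]: "X i \<in> measurable M N" if "i \<in> I \<union> J" for i
    using indep that by (auto simp: indep_vars_def)
  have m: "m \<noteq> 0" and Spos: "S > 0"
    using lam by (auto simp: S_def zero_less_mult_iff)
  have q0: "q k \<ge> 0" if "k \<in> K" for k
  proof -
    have "I \<noteq> {}" using m card by auto
    then obtain i where "i \<in> I" by auto
    then have "q k = prob {\<omega> \<in> space M. X i \<omega> \<in> A k}" using that q by auto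
    then show ?thesis by simp
  qed
  have Amem [measurable]: "A k \<in> sets N" if "k \<in> K" for k using A that by auto
  have int_ind: "integrable M (\<lambda>\<omega>. indicator (A k) (X i \<omega>) :: real)"
    if "i \<in> I \<union> J" "k \<in> K" for i k
  proof -
    have [measurable]: "X i \<in> measurable M N" "A k \<in> sets N" using that X A(1) by auto
    show ?thesis by (intro integrable_const_bound[where B = 1]) (auto simp: indicator_def)
  qed
  have Ubd: "\<bar>U B k \<omega>\<bar> \<le> real (card B)" for B k \<omega>
  proof -
    have "\<bar>U B k \<omega>\<bar> \<le> (\<Sum>i\<in>B. \<bar>indicator (A k) (X i \<omega>) :: real\<bar>)"
      unfolding U_def by (rule sum_abs)
    also have "\<dots> \<le> (\<Sum>i\<in>B. 1)" by (intro sum_mono) (auto simp: indicator_def)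
    finally show ?thesis by simp
  qed
  have Umeas [measurable]: "U B k \<in> borel_measurable M" if "B \<subseteq> I \<union> J" "k \<in> K" for B k
    unfolding U_def [abs_def]
    using that by (intro borel_measurable_sum measurable_compose[OF X borel_measurable_indicator] Amem) auto
  have intU: "integrable M (U B k)" if "B \<subseteq> I \<union> J" "k \<in> K" for B k
    using that Ubd by (intro integrable_const_bound[where B = "real (card B)"]) auto
  have intUU: "integrable M (\<lambda>\<omega>. U B k \<omega> * U B l \<omega>)"
    if "B \<subseteq> I \<union> J" "k \<in> K" "l \<in> K" for B k l
    using that Ubd
    by (intro integrable_const_bound[where B = "real (card B) * real (card B)"])
       (auto simp: abs_mult intro!: mult_mono)
  have ind_int: "expectation (\<lambda>\<omega>. indicator (A k) (X i \<omega>)) = q k"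
    if "i \<in> I \<union> J" "k \<in> K" for i k
  proof -
    have "expectation (\<lambda>\<omega>. indicator (A k) (X i \<omega>)) =
        expectation (indicator {\<omega> \<in> space M. X i \<omega> \<in> A k} :: 'a \<Rightarrow> real)"
      by (intro Bochner_Integration.integral_cong) (auto simp: indicator_def)
    also have "\<dots> = q k" using that q by (simp add: Collect_conj_eq [symmetric] Int_absorb2)
    finally show ?thesis .
  qed
  have EU: "expectation (U B k) = real (card B) * q k" if "B \<subseteq> I \<union> J" "k \<in> K" for B k
  proof -
    have "expectation (U B k) = (\<Sum>i\<in>B. expectation (\<lambda>\<omega>. indicator (A k) (X i \<omega>)))"
      unfolding U_def [abs_def] using that
      by (intro Bochner_Integration.integral_sum int_ind) auto
    also have "\<dots> = (\<Sum>i\<in>B. q k)" using that by (intro sum.cong ind_int) auto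
    finally show ?thesis by simp
  qed
  \<comment> \<open>The cells are disjoint, so one observation cannot lie in two of them; two observations are independent.\<close>
  have pair: "expectation (\<lambda>\<omega>. indicator (A k) (X i \<omega>) * indicator (A l) (X j \<omega>))
      \<le> q k * q l + (if i = j \<and> k = l then q k else 0)"
    if "i \<in> I \<union> J" "j \<in> I \<union> J" "k \<in> K" "l \<in> K" for i j k l
  proof (cases "i = j")
    case True
    show ?thesis
    proof (cases "k = l")
      case kl: True
      have "(\<lambda>\<omega>. indicator (A k) (X i \<omega>) * indicator (A l) (X j \<omega>)) =
          (\<lambda>\<omega>. indicator (A k) (X i \<omega>) :: real)"
        using True kl by (auto simp: fun_eq_iff indicator_def)
      then show ?thesis using True kl that ind_int q0 by simp
    next
      case False
      then have "A k \<inter> A l = {}" using A(2) that by (auto simp: disjoint_family_on_def)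
      then have "(\<lambda>\<omega>. indicator (A k) (X i \<omega>) * indicator (A l) (X j \<omega>)) = (\<lambda>\<omega>. 0 :: real)"
        using True by (auto simp: fun_eq_iff indicator_def)
      then show ?thesis using False q0 that by simp
    qed
  next
    case False
    have "indep_var N ((\<lambda>x. x i) \<circ> (\<lambda>\<omega>. \<lambda>i\<in>{i}. X i \<omega>)) N ((\<lambda>x. x j) \<circ> (\<lambda>\<omega>. \<lambda>i\<in>{j}. X i \<omega>))"
      using False that by (intro indep_var_compose[OF indep_var_restrict[OF indep]]) auto
    then have "indep_var N (X i) N (X j)" by (simp add: comp_def)
    then have "indep_var borel (indicator (A k) \<circ> X i :: 'a \<Rightarrow> real) borel (indicator (A l) \<circ> X j :: 'a \<Rightarrow> real)"
      using that by (intro indep_var_compose) auto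
    from indep_var_lebesgue_integral[OF this] 
    have "expectation (\<lambda>\<omega>. (indicator (A k) \<circ> X i) \<omega> * (indicator (A l) \<circ> X j) \<omega> :: real) =
      expectation (indicator (A k) \<circ> X i) * expectation (indicator (A l) \<circ> X j)"
      using that int_ind by (simp add: comp_def)
    then show ?thesis using that False ind_int by (simp add: comp_def)
  qed
  have EUU: "expectation (\<lambda>\<omega>. U B k \<omega> * U B l \<omega>)
      \<le> (real m)\<^sup>2 * q k * q l + (if k = l then real m * q k else 0)"
    if "B \<subseteq> I \<union> J" "k \<in> K" "l \<in> K" "card B = m" "finite B" for B k l
  proof -
    have "expectation (\<lambda>\<omega>. U B k \<omega> * U B l \<omega>) =
      expectation (\<lambda>\<omega>. \<Sum>i\<in>B. \<Sum>j\<in>B. indicator (A k) (X i \<omega>) * indicator (A l) (X j \<omega>))"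
      unfolding U_def sum_product ..
    also have "\<dots> = (\<Sum>i\<in>B. \<Sum>j\<in>B. expectation (\<lambda>\<omega>. indicator (A k) (X i \<omega>) * indicator (A l) (X j \<omega>)))"
    proof -
      have int: "integrable M (\<lambda>\<omega>. indicator (A k) (X i \<omega>) * indicator (A l) (X j \<omega>) :: real)"
        if ij: "i \<in> B" "j \<in> B" for i j
      proof -
        have [measurable]: "X i \<in> measurable M N" "X j \<in> measurable M N"
          "A k \<in> sets N" "A l \<in> sets N" using ij X that \<open>B \<subseteq> I \<union> J\<close> \<open>k \<in> K\<close> \<open>l \<in> K\<close> Amem by auto
        show ?thesis
          by (intro integrable_const_bound[where B = 1]) (auto simp: indicator_def)
      qed
      then show ?thesis
        by (subst Bochner_Integration.integral_sum)
           (auto intro!: Bochner_Integration.integrable_sum sum.cong Bochner_Integration.integral_sum)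
    qed
    also have "\<dots> \<le> (\<Sum>i\<in>B. \<Sum>j\<in>B. q k * q l + (if i = j \<and> k = l then q k else 0))"
      using that by (intro sum_mono pair) auto
    also have "\<dots> = (real m)\<^sup>2 * q k * q l + (if k = l then real m * q k else 0)"
      using that by (simp add: sum.distrib power2_eq_square)
    finally show ?thesis .
  qed
  have indepU: "expectation (\<lambda>\<omega>. f (\<lambda>i\<in>I. X i \<omega>) * g (\<lambda>i\<in>J. X i \<omega>)) =
      expectation (\<lambda>\<omega>. f (\<lambda>i\<in>I. X i \<omega>)) * expectation (\<lambda>\<omega>. g (\<lambda>i\<in>J. X i \<omega>))"
    if "f \<in> borel_measurable (PiM I (\<lambda>_. N))" "g \<in> borel_measurable (PiM J (\<lambda>_. N))"
       "integrable M (\<lambda>\<omega>. f (\<lambda>i\<in>I. X i \<omega>))" "integrable M (\<lambda>\<omega>. g (\<lambda>i\<in>J. X i \<omega>))"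
    for f g :: "('i \<Rightarrow> 'b) \<Rightarrow> real"
  proof -
    have "indep_var borel (f \<circ> (\<lambda>\<omega>. \<lambda>i\<in>I. X i \<omega>)) borel (g \<circ> (\<lambda>\<omega>. \<lambda>i\<in>J. X i \<omega>))"
      by (rule indep_var_compose[OF indep_var_restrict[OF indep disj]]) (use that in auto)
    from indep_var_lebesgue_integral[OF this] that show ?thesis by (simp add: comp_def)
  qed
  \<comment> \<open>The counts as functions of the restricted family, the form in which independence of the groups is available.\<close>
  define u where "u B k f = (\<Sum>i\<in>B. indicator (A k) (f i) :: real)" for B :: "'i set" and k f
  have umeas [measurable]: "u B k \<in> borel_measurable (PiM B (\<lambda>_. N))" if "k \<in> K" for B k
    unfolding u_def [abs_def]
    using that by (intro borel_measurable_sum measurable_compose[OF measurable_component_singleton borel_measurable_indicator] Amem) auto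
  have Uu: "U B k \<omega> = u B k (\<lambda>i\<in>B. X i \<omega>)" for B k \<omega>
    unfolding U_def u_def by (intro sum.cong) auto
  have EW: "expectation W = (real m)\<^sup>2 * S"
  proof -
    have e: "expectation (\<lambda>\<omega>. U I k \<omega> * U J k \<omega>) = (real m)\<^sup>2 * (q k)\<^sup>2" if "k \<in> K" for k
    proof -
      have "expectation (\<lambda>\<omega>. U I k \<omega> * U J k \<omega>) = expectation (U I k) * expectation (U J k)"
        unfolding Uu [abs_def]
        by (rule indepU[of "u I k" "u J k"])
           (use that umeas intU[of I k] intU[of J k] in \<open>simp_all only: Uu [abs_def], auto\<close>)
      then show ?thesis using that EU card by (simp add: power2_eq_square)
    qed
    have "expectation W = (\<Sum>k\<in>K. expectation (\<lambda>\<omega>. U I k \<omega> * U J k \<omega>))"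
      unfolding W_def [abs_def]
    proof (rule Bochner_Integration.integral_sum)
      fix k assume "k \<in> K"
      then show "integrable M (\<lambda>\<omega>. U I k \<omega> * U J k \<omega>)" using Ubd
        by (intro integrable_const_bound[where B = "real (card I) * real (card J)"])
           (auto simp: abs_mult intro!: mult_mono)
    qed
    also have "\<dots> = (\<Sum>k\<in>K. (real m)\<^sup>2 * (q k)\<^sup>2)" by (intro sum.cong e) auto
    finally show ?thesis by (simp add: S_def sum_distrib_left)
  qed
  have Wmeas [measurable]: "W \<in> borel_measurable M"
    unfolding W_def [abs_def] by measurable
  have Wbd: "\<bar>W \<omega>\<bar> \<le> real (card K) * (real m * real m)" for \<omega>
  proof -
    have "\<bar>W \<omega>\<bar> \<le> (\<Sum>k\<in>K. \<bar>U I k \<omega> * U J k \<omega>\<bar>)" unfolding W_def by (rule sum_abs)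
    also have "\<dots> \<le> (\<Sum>k\<in>K. real m * real m)"
      using Ubd[of I] Ubd[of J] card by (intro sum_mono) (auto simp: abs_mult intro!: mult_mono)
    finally show ?thesis by simp
  qed
  have intW: "integrable M W" and intW2: "integrable M (\<lambda>\<omega>. (W \<omega>)\<^sup>2)"
  proof -
    show "integrable M W" using Wbd
      by (intro integrable_const_bound[where B = "real (card K) * (real m * real m)"]) auto
    show "integrable M (\<lambda>\<omega>. (W \<omega>)\<^sup>2)" using Wbd
      by (intro integrable_const_bound[where B = "(real (card K) * (real m * real m))\<^sup>2"])
         (auto simp: abs_le_square_iff[symmetric] abs_mult)
  qed
  have EW2: "expectation (\<lambda>\<omega>. (W \<omega>)\<^sup>2) \<le>
      ((real m)\<^sup>2 * S)\<^sup>2 + 2 * (real m)^3 * (\<Sum>k\<in>K. (q k)^3) + (real m)\<^sup>2 * S"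
  proof -
    have Wsq: "(W \<omega>)\<^sup>2 = (\<Sum>k\<in>K. \<Sum>l\<in>K. (U I k \<omega> * U I l \<omega>) * (U J k \<omega> * U J l \<omega>))" for \<omega>
      unfolding W_def power2_eq_square sum_product by (intro sum.cong) (auto simp: algebra_simps)
    have "expectation (\<lambda>\<omega>. (W \<omega>)\<^sup>2) =
        (\<Sum>k\<in>K. \<Sum>l\<in>K. expectation (\<lambda>\<omega>. (U I k \<omega> * U I l \<omega>) * (U J k \<omega> * U J l \<omega>)))"
    proof -
      have "integrable M (\<lambda>\<omega>. (U I k \<omega> * U I l \<omega>) * (U J k \<omega> * U J l \<omega>))"
        if "k \<in> K" "l \<in> K" for k l
        using that Ubd
        by (intro integrable_const_bound[where B = "(real (card I) * real (card I)) * (real (card J) * real (card J))"])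
           (auto simp: abs_mult intro!: mult_mono)
      then show ?thesis unfolding Wsq
        by (subst Bochner_Integration.integral_sum)
           (auto intro!: Bochner_Integration.integrable_sum sum.cong Bochner_Integration.integral_sum)
    qed
    also have "\<dots> \<le> (\<Sum>k\<in>K. \<Sum>l\<in>K. ((real m)\<^sup>2 * q k * q l + (if k = l then real m * q k else 0))\<^sup>2)"
    proof (intro sum_mono)
      fix k l assume kl: "k \<in> K" "l \<in> K"
      have "expectation (\<lambda>\<omega>. (U I k \<omega> * U I l \<omega>) * (U J k \<omega> * U J l \<omega>)) =
         expectation (\<lambda>\<omega>. U I k \<omega> * U I l \<omega>) * expectation (\<lambda>\<omega>. U J k \<omega> * U J l \<omega>)"
        unfolding Uu
        by (rule indepU[of "\<lambda>x. u I k x * u I l x" "\<lambda>x. u J k x * u J l x"])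
           (use kl umeas intUU[of I k l] intUU[of J k l] in \<open>auto simp: Uu\<close>)
      also have "\<dots> \<le> ((real m)\<^sup>2 * q k * q l + (if k = l then real m * q k else 0)) *
          ((real m)\<^sup>2 * q k * q l + (if k = l then real m * q k else 0))"
        using kl card fin q0
        by (intro mult_mono EUU) (auto intro!: integral_nonneg_AE add_nonneg_nonneg mult_nonneg_nonneg simp: U_def sum_nonneg)
      finally show "expectation (\<lambda>\<omega>. (U I k \<omega> * U I l \<omega>) * (U J k \<omega> * U J l \<omega>)) \<le>
          ((real m)\<^sup>2 * q k * q l + (if k = l then real m * q k else 0))\<^sup>2"
        by (simp add: power2_eq_square)
    qed
    also have "\<dots> = (\<Sum>k\<in>K. \<Sum>l\<in>K. (real m)^4 * ((q k)\<^sup>2 * (q l)\<^sup>2) +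
        (if k = l then 2 * (real m)^3 * (q k)^3 + (real m)\<^sup>2 * (q k)\<^sup>2 else 0))"
      by (intro sum.cong) (auto simp: power2_eq_square power3_eq_cube power4_eq_xxxx algebra_simps)
    also have "\<dots> = (real m)^4 * (S * S) + (2 * (real m)^3 * (\<Sum>k\<in>K. (q k)^3) + (real m)\<^sup>2 * S)"
      using finK unfolding S_def sum_product
      by (simp add: sum.distrib sum_distrib_left)
    finally show ?thesis by (simp add: power2_eq_square power4_eq_xxxx algebra_simps)
  qed
  \<comment> \<open>The largest cell probability is at most \<open>sqrt S\<close>, so \<open>S\<close> and \<open>m\<close> alone control the cubic term.\<close>
  have cube: "(\<Sum>k\<in>K. (q k)^3) \<le> sqrt S * S"
  proof -
    have "(\<Sum>k\<in>K. (q k)^3) \<le> (\<Sum>k\<in>K. sqrt S * (q k)\<^sup>2)"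
    proof (intro sum_mono)
      fix k assume k: "k \<in> K"
      have "(q k)\<^sup>2 \<le> S" unfolding S_def by (rule member_le_sum) (use k finK in auto)
      then have "q k \<le> sqrt S" by (simp add: real_le_rsqrt)
      then have "q k * (q k)\<^sup>2 \<le> sqrt S * (q k)\<^sup>2" by (intro mult_right_mono) auto
      then show "(q k)^3 \<le> sqrt S * (q k)\<^sup>2" by (simp add: power3_eq_cube power2_eq_square)
    qed
    then show ?thesis by (simp add: sum_distrib_left[symmetric] S_def)
  qed
  have lamS: "lam = (real m)\<^sup>2 * S" using lam S_def by simp
  have sq: "sqrt lam = real m * sqrt S" by (simp add: lamS real_sqrt_mult)
  have var: "variance W \<le> 2 * lam * sqrt lam + lam"
  proof -
    have "variance W = expectation (\<lambda>\<omega>. (W \<omega>)\<^sup>2) - (expectation W)\<^sup>2"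
      using intW intW2 by (rule variance_eq)
    also have "\<dots> \<le> 2 * (real m)^3 * (sqrt S * S) + (real m)\<^sup>2 * S"
      using EW2 mult_left_mono[OF cube, of "2 * (real m)^3"] unfolding EW by simp
    also have "\<dots> = 2 * lam * sqrt lam + lam"
      unfolding sq unfolding lamS by (simp add: power2_eq_square power3_eq_cube algebra_simps)
    finally show ?thesis .
  qed
  have "prob {\<omega> \<in> space M. \<forall>i\<in>I. \<forall>j\<in>J. \<forall>k\<in>K. \<not> (X i \<omega> \<in> A k \<and> X j \<omega> \<in> A k)}
      \<le> prob {\<omega> \<in> space M. lam \<le> \<bar>W \<omega> - expectation W\<bar>}"
  proof (rule finite_measure_mono)
    show "{\<omega> \<in> space M. lam \<le> \<bar>W \<omega> - expectation W\<bar>} \<in> sets M" by measurable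
    show "{\<omega> \<in> space M. \<forall>i\<in>I. \<forall>j\<in>J. \<forall>k\<in>K. \<not> (X i \<omega> \<in> A k \<and> X j \<omega> \<in> A k)}
      \<subseteq> {\<omega> \<in> space M. lam \<le> \<bar>W \<omega> - expectation W\<bar>}"
    proof safe
      fix \<omega> assume no: "\<forall>i\<in>I. \<forall>j\<in>J. \<forall>k\<in>K. \<not> (X i \<omega> \<in> A k \<and> X j \<omega> \<in> A k)"
      have "W \<omega> = 0" unfolding W_def U_def sum_product
        by (intro sum.neutral ballI) (use no in \<open>auto simp: indicator_def\<close>)
      then show "lam \<le> \<bar>W \<omega> - expectation W\<bar>" by (simp add: EW lamS)
    qed
  qed
  also have "\<dots> \<le> variance W / lam\<^sup>2"
    using intW2 lam by (intro Chebyshev_inequality) auto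
  also have "\<dots> \<le> (2 * lam * sqrt lam + lam) / lam\<^sup>2"
    using var by (intro divide_right_mono) auto
  also have "\<dots> = 2 / sqrt lam + 1 / lam"
  proof -
    have alg: "(2 * w\<^sup>2 * w + w\<^sup>2) / (w\<^sup>2)\<^sup>2 = 2 / w + 1 / w\<^sup>2" if "w > 0" for w :: real
      using that by (simp add: power2_eq_square field_simps)
    have w: "(sqrt lam)\<^sup>2 = lam" "sqrt lam > 0" using lam(2) by auto
    from alg[OF w(2)] show ?thesis unfolding w(1) .
  qed
  finally show ?thesis .
qed

section \<open>Tails and truncated second moments\<close>

lemma regularly_varying_tail_ratio:
  assumes "regularly_varying_law \<mu> \<alpha>"
  shows "0 < a \<Longrightarrow> ((\<lambda>x. measure \<mu> {t. a * x \<le> \<bar>t\<bar>} / measure \<mu> {t. x \<le> \<bar>t\<bar>}) \<longlongrightarrow> a powr (- \<alpha>)) at_top"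
    and "eventually (\<lambda>x. 0 < measure \<mu> {t. x \<le> \<bar>t\<bar>}) at_top"
proof -
  define H where "H x = measure \<mu> {t. x \<le> \<bar>t\<bar>}" for x
  obtain L where L: "slowly_varying L" "H \<sim>[at_top] (\<lambda>x. L x * x powr (- \<alpha>))"
    using assms unfolding regularly_varying_law_def H_def by auto
  define T where "T x = L x * x powr (- \<alpha>)" for x
  have HT: "H \<sim>[at_top] T" using L(2) by (simp add: T_def [abs_def])
  have L0: "eventually (\<lambda>x. L x \<noteq> 0) at_top"
  proof -
    have "((\<lambda>x. L (1 * x) / L x) \<longlongrightarrow> 1) at_top" using L(1) unfolding slowly_varying_def by (metis zero_less_one)
    then have "eventually (\<lambda>x. L (1 * x) / L x > 0) at_top" by (rule order_tendstoD) simp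
    then show ?thesis by eventually_elim auto
  qed
  have T0: "eventually (\<lambda>x. T x \<noteq> 0) at_top"
    using L0 eventually_gt_at_top[of 0] by eventually_elim (auto simp: T_def)
  have ratio: "((\<lambda>x. H x / T x) \<longlongrightarrow> 1) at_top"
    by (rule asymp_equivD_strong[OF HT]) (use T0 in eventually_elim, auto)
  have "eventually (\<lambda>x. H x / T x > 0) at_top" using ratio by (rule order_tendstoD) simp
  then have Hpos: "eventually (\<lambda>x. 0 < H x) at_top"
    by eventually_elim (metis H_def div_0 less_irrefl measure_nonneg order_le_less)
  then show "eventually (\<lambda>x. 0 < measure \<mu> {t. x \<le> \<bar>t\<bar>}) at_top" by (simp add: H_def)
  show "((\<lambda>x. measure \<mu> {t. a * x \<le> \<bar>t\<bar>} / measure \<mu> {t. x \<le> \<bar>t\<bar>}) \<longlongrightarrow> a powr (- \<alpha>)) at_top" if "0 < a"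
  proof -
    have lin: "filterlim (\<lambda>x. a * x) at_top at_top"
      using that by (simp add: filterlim_tendsto_pos_mult_at_top[OF tendsto_const _ filterlim_ident])
    \<comment> \<open>The ratio factors through the regularly varying model \<open>T\<close>; the powers of \<open>x\<close> cancel.\<close>
    have "((\<lambda>x. (H (a * x) / T (a * x)) * (L (a * x) / L x * a powr (- \<alpha>)) / (H x / T x))
        \<longlongrightarrow> 1 * (1 * a powr (- \<alpha>)) / 1) at_top"
      using L(1) that unfolding slowly_varying_def
      by (intro tendsto_intros ratio filterlim_compose[OF ratio lin]) auto
    moreover have "eventually (\<lambda>x. (H (a * x) / T (a * x)) * (L (a * x) / L x * a powr (- \<alpha>)) / (H x / T x)
        = H (a * x) / H x) at_top"
      using T0 L0 Hpos eventually_compose_filterlim[OF T0 lin] eventually_gt_at_top[of 0]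
    proof eventually_elim
      case (elim x)
      then show ?case using that by (simp add: T_def powr_mult field_simps)
    qed
    ultimately show ?thesis
      unfolding H_def [symmetric] by (simp add: tendsto_cong)
  qed
qed

text \<open>The ratio of the tails at \<open>2 x\<close> and \<open>x\<close> tends to \<open>2 powr (- \<alpha>)\<close>, which exceeds
  \<open>1/4\<close> exactly because \<open>\<alpha> < 2\<close>. This margin over \<open>1/4\<close> is what makes truncated
  second moments comparable to the tail in the next lemma.\<close>

lemma regularly_varying_doubling:
  assumes "regularly_varying_law \<mu> \<alpha>"
  obtains r m0 where "1/4 < r" "r < 1" "\<And>m. m \<ge> m0 \<Longrightarrow> 0 < measure \<mu> {t. 2 ^ m \<le> \<bar>t\<bar>}"
    "\<And>m. m \<ge> m0 \<Longrightarrow> r * measure \<mu> {t. 2 ^ m \<le> \<bar>t\<bar>} \<le> measure \<mu> {t. 2 ^ Suc m \<le> \<bar>t\<bar>}"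
proof -
  have \<alpha>: "0 < \<alpha>" "\<alpha> < 2" using assms by (auto simp: regularly_varying_law_def)
  have "(2::real) powr (- 2) < 2 powr (- \<alpha>)" using \<alpha> by (intro powr_less_mono) auto
  moreover have "(2::real) powr (- 2) = 1/4" by (simp add: powr_minus powr_numeral)
  ultimately obtain r where r: "1/4 < r" "r < 2 powr (- \<alpha>)"
    using dense[of "1/4" "(2::real) powr (- \<alpha>)"] by auto
  have "(2::real) powr (- \<alpha>) < 2 powr 0" using \<alpha> by (intro powr_less_mono) auto
  then have r1: "r < 1" using r by simp
  have lim: "filterlim (\<lambda>m. (2::real) ^ m) at_top sequentially"
    by real_asymp
  have "eventually (\<lambda>x. r < measure \<mu> {t. 2 * x \<le> \<bar>t\<bar>} / measure \<mu> {t. x \<le> \<bar>t\<bar>}) at_top"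
    by (rule order_tendstoD(1)[OF regularly_varying_tail_ratio(1)[OF assms]]) (use r in simp_all)
  then have "eventually (\<lambda>x. 0 < measure \<mu> {t. x \<le> \<bar>t\<bar>} \<and>
      r * measure \<mu> {t. x \<le> \<bar>t\<bar>} \<le> measure \<mu> {t. 2 * x \<le> \<bar>t\<bar>}) at_top"
    using regularly_varying_tail_ratio(2)[OF assms]
    by eventually_elim (auto simp: field_simps)
  from eventually_compose_filterlim[OF this lim]
  obtain m0 where "\<forall>m\<ge>m0. 0 < measure \<mu> {t. 2 ^ m \<le> \<bar>t\<bar>} \<and>
      r * measure \<mu> {t. 2 ^ m \<le> \<bar>t\<bar>} \<le> measure \<mu> {t. 2 * 2 ^ m \<le> \<bar>t\<bar>}"
    unfolding eventually_sequentially by auto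
  then show ?thesis using r r1 by (intro that[of r m0]) auto
qed

text \<open>A one-sided form of Karamata's theorem along powers of two, with \<open>min (t\<^sup>2) (4 ^ m)\<close>
  in place of a sharp cutoff. Raising \<open>m\<close> by one raises the integrand by at most \<open>4 ^ Suc m\<close>,
  and only where \<open>2 ^ m \<le> \<bar>t\<bar>\<close>; on the right-hand side \<open>4 ^ m\<close> times the tail grows by
  a factor of at least \<open>4 r > 1\<close>, which leaves room to absorb the increment when \<open>C\<close> is
  large.\<close>

lemma dyadic_karamata:
  fixes \<mu> :: "real measure"
  assumes "real_distribution \<mu>" and r: "1/4 < r"
    and pos: "\<And>m. m \<ge> m0 \<Longrightarrow> 0 < measure \<mu> {t. 2 ^ m \<le> \<bar>t\<bar>}"
    and dbl: "\<And>m. m \<ge> m0 \<Longrightarrow> r * measure \<mu> {t. 2 ^ m \<le> \<bar>t\<bar>} \<le> measure \<mu> {t. 2 ^ Suc m \<le> \<bar>t\<bar>}"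
  obtains C where "0 < C"
    "\<And>m. m \<ge> m0 \<Longrightarrow> (\<integral>t. min (t\<^sup>2) (4 ^ m) \<partial>\<mu>) \<le> C * 4 ^ m * measure \<mu> {t. 2 ^ m \<le> \<bar>t\<bar>}"
proof -
  interpret real_distribution \<mu> by fact
  define H where "H m = measure \<mu> {t. 2 ^ m \<le> \<bar>t\<bar>}" for m :: nat
  define G where "G m = (\<integral>t. min (t\<^sup>2) (4 ^ m) \<partial>\<mu>)" for m :: nat
  have int: "integrable \<mu> (\<lambda>t. min (t\<^sup>2) (4 ^ m))" for m :: nat
    by (intro integrable_const_bound[where B = "4 ^ m"]) auto
  have step: "G (Suc m) \<le> G m + 4 ^ Suc m * H m" for m
  proof -
    have int2: "integrable \<mu> (\<lambda>t. 4 ^ Suc m * indicator {t. 2 ^ m \<le> \<bar>t\<bar>} t :: real)"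
      by (intro integrable_mult_right integrable_real_indicator) (auto simp: emeasure_eq_measure)
    have "G (Suc m) \<le> (\<integral>t. min (t\<^sup>2) (4 ^ m) + 4 ^ Suc m * indicator {t. 2 ^ m \<le> \<bar>t\<bar>} t \<partial>\<mu>)"
      unfolding G_def
    proof (intro integral_mono int Bochner_Integration.integrable_add int2)
      fix t :: real
      show "min (t\<^sup>2) (4 ^ Suc m) \<le> min (t\<^sup>2) (4 ^ m) + 4 ^ Suc m * indicator {t. 2 ^ m \<le> \<bar>t\<bar>} t"
      proof (cases "2 ^ m \<le> \<bar>t\<bar>")
        case False
        then have "\<bar>t\<bar>\<^sup>2 \<le> (2 ^ m)\<^sup>2" by (intro power_mono) auto
        then have "t\<^sup>2 \<le> 4 ^ m" by (simp add: power2_eq_square power_mult_distrib[symmetric])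
        then show ?thesis using False by simp
      qed (auto simp: min_def)
    qed
    also have "\<dots> = G m + 4 ^ Suc m * H m"
      unfolding G_def H_def by (subst Bochner_Integration.integral_add[OF int int2]) simp
    finally show ?thesis .
  qed
  \<comment> \<open>The first argument makes the induction step work, the second its base case.\<close>
  define C where "C = max (4 / (4 * r - 1)) (G m0 / (4 ^ m0 * H m0))"
  have C: "4 / (4 * r - 1) \<le> C" "G m0 / (4 ^ m0 * H m0) \<le> C" by (auto simp: C_def)
  have "0 < 4 / (4 * r - 1)" using r by simp
  then have C0: "0 < C" using C by linarith
  have C4: "C + 4 \<le> 4 * r * C" using C(1) r by (simp add: field_simps)
  have "G m \<le> C * 4 ^ m * H m" if "m \<ge> m0" for m
    using that
  proof (induction m rule: dec_induct)
    case base
    then show ?case using C(2) pos[of m0] by (simp add: field_simps H_def)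
  next
    case (step m)
    have "G (Suc m) \<le> (C + 4) * (4 ^ m * H m)"
      using step \<open>G (Suc m) \<le> G m + 4 ^ Suc m * H m\<close> by (simp add: algebra_simps)
    also have "\<dots> \<le> (4 * r * C) * (4 ^ m * H m)"
      using C4 by (intro mult_right_mono) (auto simp: H_def)
    also have "\<dots> = C * 4 ^ Suc m * (r * H m)" by simp
    also have "\<dots> \<le> C * 4 ^ Suc m * H (Suc m)"
      using dbl[of m] step C0 unfolding H_def by (intro mult_left_mono) auto
    finally show ?case .
  qed
  then show ?thesis using C0 by (intro that[of C]) (auto simp: G_def H_def)
qed

section \<open>Vectors dominated by one coordinate\<close>

text \<open>The vectors of the unit sphere with all but at most \<open>\<delta>\<close> of their squared length in
  coordinate \<open>k\<close>. Only the sign of the parameter \<open>s\<close> matters: it fixes the sign of that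
  coordinate, so that two vectors of the set are nearly equal rather than nearly opposite.\<close>

definition dominated_by :: "nat \<Rightarrow> real \<Rightarrow> real \<Rightarrow> nat \<Rightarrow> (nat \<Rightarrow> real) set" where
  "dominated_by p \<delta> s k =
     {y \<in> space (Rvec p). (\<Sum>j<p. (y j)\<^sup>2) = 1 \<and> 0 < s * y k \<and> 1 - \<delta> \<le> (y k)\<^sup>2}"

lemma sets_dominated_by: "k < p \<Longrightarrow> dominated_by p \<delta> s k \<in> sets (Rvec p)"
  unfolding dominated_by_def by measurable

lemma disjoint_dominated_by:
  assumes "\<delta> < 1/2"
  shows "disjoint_family_on (dominated_by p \<delta> s) {..<p}"
proof -
  have False if "k < p" "l < p" "k \<noteq> l" "y \<in> dominated_by p \<delta> s k" "y \<in> dominated_by p \<delta> s l" for k l y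
  proof -
    have "(y k)\<^sup>2 + (y l)\<^sup>2 = (\<Sum>j\<in>{k, l}. (y j)\<^sup>2)" using that by simp
    also have "\<dots> \<le> (\<Sum>j<p. (y j)\<^sup>2)" using that by (intro sum_mono2) auto
    finally show False using that assms by (simp add: dominated_by_def)
  qed
  then show ?thesis unfolding disjoint_family_on_def by blast
qed

text \<open>The two dominating entries have equal sign and contribute at least \<open>1 - \<delta>\<close>; the
  remaining entries have squared length at most \<open>\<delta>\<close> in both vectors, hence contribute at
  least \<open>- \<delta>\<close>.\<close>

lemma inner_vec_dominated_by:
  assumes "y \<in> dominated_by p \<delta> s k" "z \<in> dominated_by p \<delta> s k" "k < p" "\<delta> < 1"
  shows "1 - 2 * \<delta> \<le> inner_vec p y z"
proof -
  have split: "(\<Sum>j<p. f j) = f k + (\<Sum>j\<in>{..<p} - {k}. f j)" for f :: "nat \<Rightarrow> real"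
    using assms by (simp add: sum.remove)
  have y: "(\<Sum>j<p. (y j)\<^sup>2) = 1" "0 < s * y k" "1 - \<delta> \<le> (y k)\<^sup>2"
   and z: "(\<Sum>j<p. (z j)\<^sup>2) = 1" "0 < s * z k" "1 - \<delta> \<le> (z k)\<^sup>2"
    using assms by (auto simp: dominated_by_def)
  have "0 < y k * z k" using y z by (auto simp: zero_less_mult_iff)
  moreover have "(1 - \<delta>) * (1 - \<delta>) \<le> (y k)\<^sup>2 * (z k)\<^sup>2" using y z assms by (intro mult_mono) auto
  then have "(1 - \<delta>)\<^sup>2 \<le> (y k * z k)\<^sup>2" by (simp add: power2_eq_square algebra_simps)
  ultimately have main: "1 - \<delta> \<le> y k * z k" by (meson less_imp_le power2_le_imp_le)
  have "- (\<Sum>j\<in>{..<p} - {k}. y j * z j) = (\<Sum>j\<in>{..<p} - {k}. - (y j * z j))"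
    by (simp add: sum_negf)
  also have "\<dots> \<le> (\<Sum>j\<in>{..<p} - {k}. ((y j)\<^sup>2 + (z j)\<^sup>2) / 2)"
  proof (intro sum_mono)
    fix j
    have "0 \<le> (y j + z j)\<^sup>2" by simp
    then show "- (y j * z j) \<le> ((y j)\<^sup>2 + (z j)\<^sup>2) / 2" by (simp add: power2_sum)
  qed
  also have "\<dots> \<le> \<delta>"
    using y z split[of "\<lambda>j. (y j)\<^sup>2"] split[of "\<lambda>j. (z j)\<^sup>2"]
    by (simp add: sum_divide_distrib[symmetric] sum.distrib)
  finally show ?thesis using main split[of "\<lambda>j. y j * z j"] by (simp add: inner_vec_def)
qed

lemma inner_vec_le_1:
  assumes "(\<Sum>j<p. (y j)\<^sup>2) = 1" "(\<Sum>j<p. (z j)\<^sup>2) = 1"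
  shows "inner_vec p y z \<le> 1"
proof -
  have "inner_vec p y z \<le> (\<Sum>j<p. ((y j)\<^sup>2 + (z j)\<^sup>2) / 2)"
    unfolding inner_vec_def
  proof (intro sum_mono)
    fix j
    have "0 \<le> (y j - z j)\<^sup>2" by simp
    then show "y j * z j \<le> ((y j)\<^sup>2 + (z j)\<^sup>2) / 2" by (simp add: power2_diff)
  qed
  also have "\<dots> = 1" using assms by (simp add: sum_divide_distrib[symmetric] sum.distrib)
  finally show ?thesis .
qed

lemma integral_PiM_two_coordinates:
  fixes f g :: "'a \<Rightarrow> real"
  assumes "prob_space \<mu>" "finite I" "k \<in> I" "j \<in> I" "k \<noteq> j" "integrable \<mu> f" "integrable \<mu> g"
  shows "(\<integral>x. f (x k) * g (x j) \<partial>PiM I (\<lambda>_. \<mu>)) = (\<integral>t. f t \<partial>\<mu>) * (\<integral>t. g t \<partial>\<mu>)"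
proof -
  interpret prob_space \<mu> by fact
  interpret P: product_prob_space "\<lambda>_. \<mu>" I by unfold_locales
  define h where "h i = (if i = k then f else if i = j then g else (\<lambda>_. 1))" for i
  have two: "(\<Prod>i\<in>I. F i) = F k * F j" if "\<And>i. i \<in> I \<Longrightarrow> i \<noteq> k \<Longrightarrow> i \<noteq> j \<Longrightarrow> F i = 1" for F :: "_ \<Rightarrow> real"
  proof -
    have "(\<Prod>i\<in>I. F i) = (\<Prod>i\<in>{k, j}. F i)"
      using assms that by (intro prod.mono_neutral_right) auto
    then show ?thesis using assms by simp
  qed
  have "(\<integral>x. f (x k) * g (x j) \<partial>PiM I (\<lambda>_. \<mu>)) = (\<integral>x. (\<Prod>i\<in>I. h i (x i)) \<partial>PiM I (\<lambda>_. \<mu>))"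
    using assms by (subst two) (auto simp: h_def)
  also have "\<dots> = (\<Prod>i\<in>I. integral\<^sup>L \<mu> (h i))"
    using assms by (intro P.product_integral_prod) (auto simp: h_def)
  also have "\<dots> = (\<integral>t. f t \<partial>\<mu>) * (\<integral>t. g t \<partial>\<mu>)"
    using assms by (subst two) (auto simp: h_def prob_space)
  finally show ?thesis .
qed

text \<open>Coordinate \<open>k\<close> dominates when it is at least \<open>b\<close> in the direction \<open>s\<close> and the
  other squares sum to less than \<open>\<delta> * b\<^sup>2\<close>. Truncating these squares at \<open>b\<^sup>2\<close> does not change
  that condition, since \<open>\<delta> < 1\<close>, and gives them a finite mean. By Markov's inequality and the
  independence of coordinates \<open>k\<close> and \<open>j\<close>, the condition fails with probability at most
  one half given that coordinate \<open>k\<close> is large.\<close>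

lemma prob_dominated_by:
  assumes "real_distribution \<mu>" "\<bar>s\<bar> = 1" "k < p" "0 < \<delta>" "\<delta> < 1" "0 < b"
    and small: "real p * (\<integral>t. min (t\<^sup>2) (b\<^sup>2) \<partial>\<mu>) \<le> \<delta> * b\<^sup>2 / 2"
  shows "measure \<mu> {t. b \<le> s * t} / 2 \<le> measure (alpha_spherical \<mu> p) (dominated_by p \<delta> s k)"
proof -
  interpret real_distribution \<mu> by fact
  interpret P: product_prob_space "\<lambda>_. \<mu>" "{..<p}" by unfold_locales
  let ?P = "iid_vec \<mu> p"
  define e where "e = (\<integral>t. min (t\<^sup>2) (b\<^sup>2) \<partial>\<mu>)"
  define Q where "Q = measure \<mu> {t. b \<le> s * t}"
  define f where "f = (indicator {t. b \<le> s * t} :: real \<Rightarrow> real)"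
  define g where "g t = min (t\<^sup>2) (b\<^sup>2)" for t :: real
  have [measurable]: "f \<in> borel_measurable \<mu>" "g \<in> borel_measurable \<mu>"
    unfolding f_def g_def [abs_def] by measurable
  have coord [measurable]: "(\<lambda>x. x j) \<in> measurable ?P \<mu>" if "j < p" for j
    using that by (intro measurable_component_singleton) auto
  have fb: "0 \<le> f t" "f t \<le> 1" and gb: "0 \<le> g t" "g t \<le> b\<^sup>2" for t
    by (auto simp: f_def g_def)
  have intf: "integrable \<mu> f" using fb by (intro integrable_const_bound[where B = 1]) auto
  have intg: "integrable \<mu> g" using gb by (intro integrable_const_bound[where B = "b\<^sup>2"]) auto
  have Ef: "(\<integral>t. f t \<partial>\<mu>) = Q" by (simp add: f_def Q_def)
  have Eg: "(\<integral>t. g t \<partial>\<mu>) = e" by (simp add: g_def e_def)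
  have e0: "0 \<le> e" unfolding e_def by (intro integral_nonneg_AE) auto
  define B where "B = {x \<in> space ?P. b \<le> s * x k \<and> (\<Sum>j\<in>{..<p} - {k}. g (x j)) < \<delta> * b\<^sup>2}"
  have Bsets [measurable]: "B \<in> sets ?P"
  proof -
    have [measurable]: "(\<lambda>x. \<Sum>j\<in>{..<p} - {k}. g (x j)) \<in> borel_measurable ?P"
      by (intro borel_measurable_sum measurable_compose[OF coord]) auto
    have [measurable]: "(\<lambda>x. x k) \<in> borel_measurable ?P"
      by (rule measurable_compose[OF coord[OF assms(3)], of "\<lambda>t. t" borel]) simp
    show ?thesis unfolding B_def by measurable
  qed
  have int1: "integrable ?P (\<lambda>x. f (x k))"
    using fb assms by (intro P.integrable_const_bound[where B = 1] measurable_compose[OF coord]) auto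
  have int2: "integrable ?P (\<lambda>x. f (x k) * g (x j))" if "j < p" for j
  proof (intro P.integrable_const_bound[where B = "1 * b\<^sup>2"] AE_I2)
    show "norm (f (x k) * g (x j)) \<le> 1 * b\<^sup>2" for x
      using fb gb unfolding norm_mult by (intro mult_mono) auto
    show "(\<lambda>x. f (x k) * g (x j)) \<in> borel_measurable ?P"
      using assms that by (intro borel_measurable_times measurable_compose[OF coord]) auto
  qed
  have "Q / 2 \<le> Q - Q * (real p * e / (\<delta> * b\<^sup>2))"
  proof -
    have "real p * e / (\<delta> * b\<^sup>2) \<le> 1/2" using small assms by (simp add: e_def field_simps)
    then have "Q * (real p * e / (\<delta> * b\<^sup>2)) \<le> Q * (1/2)" by (intro mult_left_mono) (auto simp: Q_def)
    then show ?thesis by simp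
  qed
  also have "\<dots> \<le> Q - (\<Sum>j\<in>{..<p} - {k}. Q * e / (\<delta> * b\<^sup>2))"
  proof -
    have "real (p - 1) * (Q * e / (\<delta> * b\<^sup>2)) \<le> real p * (Q * e / (\<delta> * b\<^sup>2))"
      using e0 assms by (intro mult_right_mono) (auto simp: Q_def)
    then show ?thesis using assms by (simp add: algebra_simps)
  qed
  \<comment> \<open>Under the integral, the indicator of \<open>B\<close> is bounded below by a linear expression in the truncated squares.\<close>
  also have "\<dots> = (\<integral>x. f (x k) - (\<Sum>j\<in>{..<p} - {k}. f (x k) * g (x j) / (\<delta> * b\<^sup>2)) \<partial>?P)"
  proof -
    have "(\<integral>x. f (x k) \<partial>?P) = (\<integral>t. f t \<partial>distr ?P \<mu> (\<lambda>x. x k))"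
      using assms by (subst integral_distr) auto
    also have "\<dots> = Q"
      using assms by (subst P.PiM_component) (auto simp: Ef)
    finally have 1: "(\<integral>x. f (x k) \<partial>?P) = Q" .
    have 2: "(\<integral>x. f (x k) * g (x j) / (\<delta> * b\<^sup>2) \<partial>?P) = Q * e / (\<delta> * b\<^sup>2)"
      if "j \<in> {..<p} - {k}" for j
      using that assms intf intg Ef Eg
      by (simp add: integral_PiM_two_coordinates prob_space_axioms)
    have 3: "integrable ?P (\<lambda>x. f (x k) * g (x j) / (\<delta> * b\<^sup>2))" if "j \<in> {..<p} - {k}" for j
      using that int2 by (intro integrable_divide_zero) auto
    show ?thesis
      by (subst Bochner_Integration.integral_diff[OF int1 Bochner_Integration.integrable_sum[OF 3]], assumption)
         (simp only: Bochner_Integration.integral_sum[OF 3] 1 sum.cong[OF refl 2])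
  qed
  also have "\<dots> \<le> (\<integral>x. indicator B x \<partial>?P)"
  proof (rule integral_mono)
    show "integrable ?P (\<lambda>x. f (x k) - (\<Sum>j\<in>{..<p} - {k}. f (x k) * g (x j) / (\<delta> * b\<^sup>2)))"
      using int1 int2
      by (intro Bochner_Integration.integrable_diff Bochner_Integration.integrable_sum integrable_divide_zero) auto
    show "integrable ?P (indicator B :: _ \<Rightarrow> real)"
      by (intro integrable_real_indicator) (auto simp: P.emeasure_eq_measure)
    fix x assume x: "x \<in> space ?P"
    have eq: "f (x k) - (\<Sum>j\<in>{..<p} - {k}. f (x k) * g (x j) / (\<delta> * b\<^sup>2)) =
       f (x k) * (1 - (\<Sum>j\<in>{..<p} - {k}. g (x j)) / (\<delta> * b\<^sup>2))"
      by (simp add: sum_divide_distrib sum_distrib_left algebra_simps)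
    have s0: "0 \<le> (\<Sum>j\<in>{..<p} - {k}. g (x j)) / (\<delta> * b\<^sup>2)"
      using gb assms by (intro divide_nonneg_nonneg sum_nonneg) auto
    show "f (x k) - (\<Sum>j\<in>{..<p} - {k}. f (x k) * g (x j) / (\<delta> * b\<^sup>2)) \<le> indicator B x"
    proof (cases "b \<le> s * x k")
      case True
      show ?thesis unfolding eq
      proof (cases "(\<Sum>j\<in>{..<p} - {k}. g (x j)) < \<delta> * b\<^sup>2")
        case lt: True
        then have "x \<in> B" using True x by (simp add: B_def)
        then show "f (x k) * (1 - (\<Sum>j\<in>{..<p} - {k}. g (x j)) / (\<delta> * b\<^sup>2)) \<le> indicator B x"
          using s0 True by (simp add: f_def)
      next
        case False
        then have "1 \<le> (\<Sum>j\<in>{..<p} - {k}. g (x j)) / (\<delta> * b\<^sup>2)" using assms by simp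
        then show "f (x k) * (1 - (\<Sum>j\<in>{..<p} - {k}. g (x j)) / (\<delta> * b\<^sup>2)) \<le> indicator B x"
          using True by (simp add: f_def indicator_def)
      qed
    next
      case False
      then show ?thesis by (simp add: eq f_def)
    qed
  qed
  also have "\<dots> = measure ?P B" by simp
  also have "\<dots> \<le> measure ?P (self_normalize p -` dominated_by p \<delta> s k \<inter> space ?P)"
  proof (rule P.finite_measure_mono)
    show "self_normalize p -` dominated_by p \<delta> s k \<inter> space ?P \<in> sets ?P"
      using assms by (intro measurable_sets[OF measurable_self_normalize] sets_dominated_by)
    show "B \<subseteq> self_normalize p -` dominated_by p \<delta> s k \<inter> space ?P"
    proof
      fix x assume x: "x \<in> B"
      define S where "S = (\<Sum>j<p. (x j)\<^sup>2)"
      have bk: "b \<le> s * x k" and sm: "(\<Sum>j\<in>{..<p} - {k}. g (x j)) < \<delta> * b\<^sup>2" and xs: "x \<in> space ?P"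
        using x by (auto simp: B_def)
      have "b \<le> \<bar>x k\<bar>" using bk assms(2) abs_mult[of s "x k"] abs_ge_self[of "s * x k"] by simp
      then have bk2: "b\<^sup>2 \<le> (x k)\<^sup>2" using assms by (simp add: abs_le_square_iff[symmetric])
      \<comment> \<open>No truncated square reaches \<open>b\<^sup>2\<close>, so none was truncated.\<close>
      have "(x j)\<^sup>2 = g (x j)" if "j \<in> {..<p} - {k}" for j
      proof -
        have "g (x j) \<le> (\<Sum>j\<in>{..<p} - {k}. g (x j))" using that gb by (intro member_le_sum) auto
        also have "\<dots> < 1 * b\<^sup>2"
          using assms by (intro less_trans[OF sm] mult_strict_right_mono) auto
        finally show ?thesis by (auto simp: g_def)
      qed
      then have rest: "(\<Sum>j\<in>{..<p} - {k}. (x j)\<^sup>2) < \<delta> * b\<^sup>2" using sm by simp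
      have Seq: "S = (x k)\<^sup>2 + (\<Sum>j\<in>{..<p} - {k}. (x j)\<^sup>2)"
        unfolding S_def using assms by (simp add: sum.remove)
      then have Sb: "b\<^sup>2 \<le> S" using bk2 sum_nonneg[of "{..<p} - {k}" "\<lambda>j. (x j)\<^sup>2"] by simp
      moreover have "0 < b\<^sup>2" using assms by simp
      ultimately have S0: "0 < S" by linarith
      have yk: "self_normalize p x j = x j / sqrt S" if "j < p" for j
        using that by (simp add: self_normalize_def S_def)
      have "(\<Sum>j<p. (self_normalize p x j)\<^sup>2) = (\<Sum>j<p. (x j)\<^sup>2 / S)"
        using S0 by (intro sum.cong) (auto simp: yk power_divide)
      also have "\<dots> = 1" using S0 by (simp add: sum_divide_distrib[symmetric] S_def)
      finally have one: "(\<Sum>j<p. (self_normalize p x j)\<^sup>2) = 1" .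
      have pos: "0 < s * self_normalize p x k"
      proof -
        have "0 < s * x k" using bk assms by linarith
        then show ?thesis using S0 assms by (simp add: yk)
      qed
      have "\<delta> * b\<^sup>2 \<le> \<delta> * S" using Sb assms by (intro mult_left_mono) auto
      then have "(1 - \<delta>) * S \<le> (x k)\<^sup>2" using rest Seq by (simp add: algebra_simps)
      then have dom: "1 - \<delta> \<le> (self_normalize p x k)\<^sup>2"
        using S0 assms by (simp add: yk power_divide field_simps)
      have "self_normalize p x \<in> space (Rvec p)"
        by (simp add: space_PiM self_normalize_def)
      then show "x \<in> self_normalize p -` dominated_by p \<delta> s k \<inter> space ?P"
        using one pos dom xs by (simp add: dominated_by_def)
    qed
  qed
  also have "\<dots> = measure (alpha_spherical \<mu> p) (dominated_by p \<delta> s k)"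
    unfolding alpha_spherical_def
    using assms by (subst measure_distr[OF measurable_self_normalize sets_dominated_by]) auto
  finally show ?thesis by (simp add: Q_def)
qed

text \<open>The threshold is the first power of two, in the range where the doubling bound holds,
  whose tail probability multiplied by the dimension falls to a small constant \<open>\<eta>\<close>. Below \<open>\<eta>\<close>, the remaining coordinates are
  negligible by the Karamata bound; since it is the first such power and a step costs at most a
  factor \<open>r\<close>, the tail is still of the order of \<open>1 / p\<close>. As \<open>\<mu>\<close> need not be symmetric, the
  sign with the heavier tail at the threshold is chosen, and it may vary with \<open>p\<close>.\<close>

lemma prob_dominated_by_lower_bound:
  assumes rv: "regularly_varying_law \<mu> \<alpha>" and \<delta>: "0 < \<delta>" "\<delta> < 1"
  obtains c where "0 < c"
    "eventually (\<lambda>p. \<exists>s. \<forall>k<p. c / real p \<le> measure (alpha_spherical \<mu> p) (dominated_by p \<delta> s k)) sequentially"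
proof -
  have \<mu>: "real_distribution \<mu>" using rv by (simp add: regularly_varying_law_def)
  interpret real_distribution \<mu> by fact
  define H where "H m = measure \<mu> {t. 2 ^ m \<le> \<bar>t\<bar>}" for m :: nat
  obtain r m0 where r: "1/4 < r" "r < 1"
    and pos: "\<And>m. m \<ge> m0 \<Longrightarrow> 0 < H m" and dbl: "\<And>m. m \<ge> m0 \<Longrightarrow> r * H m \<le> H (Suc m)"
    using regularly_varying_doubling[OF rv] unfolding H_def by metis
  obtain C where C: "0 < C" "\<And>m. m \<ge> m0 \<Longrightarrow> (\<integral>t. min (t\<^sup>2) (4 ^ m) \<partial>\<mu>) \<le> C * 4 ^ m * H m"
    using dyadic_karamata[OF \<mu> r(1) pos[unfolded H_def] dbl[unfolded H_def]] unfolding H_def by metis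
  \<comment> \<open>With this value the Karamata bound turns into the smallness condition on the truncated moment at the threshold.\<close>
  define \<eta> where "\<eta> = \<delta> / (2 * C)"
  have \<eta>: "0 < \<eta>" using \<delta> C by (simp add: \<eta>_def)
  have Hlim: "H \<longlonglongrightarrow> 0"
  proof -
    have "(\<lambda>m. measure \<mu> {t. 2 ^ m \<le> \<bar>t\<bar>}) \<longlonglongrightarrow> measure \<mu> (\<Inter>m. {t. 2 ^ m \<le> \<bar>t\<bar>})"
    proof (intro finite_Lim_measure_decseq)
      show "range (\<lambda>m. {t. 2 ^ m \<le> \<bar>t\<bar>}) \<subseteq> events" by auto
      show "decseq (\<lambda>m. {t::real. 2 ^ m \<le> \<bar>t\<bar>})"
        by (auto simp: decseq_def intro: order_trans[OF power_increasing])
    qed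
    moreover have "(\<Inter>m. {t::real. 2 ^ m \<le> \<bar>t\<bar>}) = {}"
    proof -
      have "\<exists>m. \<not> 2 ^ m \<le> \<bar>t\<bar>" for t :: real
        using real_arch_pow[of 2 "\<bar>t\<bar>"] by (auto simp: not_le)
      then show ?thesis by blast
    qed
    ultimately show ?thesis by (simp add: H_def [abs_def])
  qed
  have "\<exists>s. \<forall>k<p. (r * \<eta> / 4) / real p \<le> measure (alpha_spherical \<mu> p) (dominated_by p \<delta> s k)"
    if p: "\<eta> / H m0 < real p" for p
  proof -
    have p0: "0 < real p" using p \<eta> pos[of m0] by (smt (verit) divide_pos_pos le_refl)
    define ok where "ok m \<longleftrightarrow> m0 \<le> m \<and> real p * H m \<le> \<eta>" for m
    have "eventually (\<lambda>m. H m < \<eta> / real p) sequentially"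
      using Hlim \<eta> p0 by (intro order_tendstoD) auto
    then have "eventually (\<lambda>m. m0 \<le> m \<and> H m < \<eta> / real p) sequentially"
      using eventually_ge_at_top[of m0] by eventually_elim auto
    then obtain m1 where "m0 \<le> m1" "H m1 < \<eta> / real p"
      using eventually_happens' sequentially_bot by blast
    then have ok1: "ok m1" using p0 by (simp add: ok_def field_simps)
    define m where "m = (LEAST m. ok m)"
    have m: "ok m" unfolding m_def using ok1 by (rule LeastI)
    have "\<not> ok m0" using p pos[of m0] by (simp add: ok_def field_simps)
    then have "m0 < m" using m unfolding ok_def using le_neq_implies_less by blast
    then obtain l where l: "m = Suc l" "m0 \<le> l" by (cases m) auto
    have "\<not> ok l" using l not_less_Least[of l ok] m_def by auto
    then have "\<eta> < real p * H l" using l by (simp add: ok_def)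
    then have "r * \<eta> \<le> r * (real p * H l)" using r by (intro mult_left_mono) auto
    also have "\<dots> \<le> real p * H m" using mult_left_mono[OF dbl[OF l(2)], of "real p"] l by (simp add: mult.left_commute)
    finally have low: "r * \<eta> / real p \<le> H m" using p0 by (simp add: field_simps)
    have "real p * (\<integral>t. min (t\<^sup>2) ((2 ^ m)\<^sup>2) \<partial>\<mu>) \<le> real p * (C * 4 ^ m * H m)"
      using C(2)[of m] m by (intro mult_left_mono) (auto simp: ok_def power_mult_distrib power2_eq_square power_mult_distrib[symmetric])
    also have "\<dots> = C * 4 ^ m * (real p * H m)" by simp
    also have "\<dots> \<le> C * 4 ^ m * \<eta>" using m C by (intro mult_left_mono) (auto simp: ok_def)
    also have "\<dots> = \<delta> * (2 ^ m)\<^sup>2 / 2" using C by (simp add: \<eta>_def power2_eq_square power_mult_distrib[symmetric])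
    finally have small: "real p * (\<integral>t. min (t\<^sup>2) ((2 ^ m)\<^sup>2) \<partial>\<mu>) \<le> \<delta> * (2 ^ m)\<^sup>2 / 2" .
    have "H m \<le> measure \<mu> ({t. 2 ^ m \<le> 1 * t} \<union> {t. 2 ^ m \<le> (-1) * t})"
      unfolding H_def by (intro finite_measure_mono) auto
    also have "\<dots> \<le> measure \<mu> {t. 2 ^ m \<le> 1 * t} + measure \<mu> {t. 2 ^ m \<le> (-1) * t}"
      by (intro measure_Un_le) auto
    finally have "H m / 2 \<le> measure \<mu> {t. 2 ^ m \<le> 1 * t} \<or> H m / 2 \<le> measure \<mu> {t. 2 ^ m \<le> (-1) * t}"
      by linarith
    then obtain s :: real where s: "\<bar>s\<bar> = 1" "H m / 2 \<le> measure \<mu> {t. 2 ^ m \<le> s * t}"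
      by (metis abs_minus_cancel abs_one)
    have "(r * \<eta> / 4) / real p \<le> measure (alpha_spherical \<mu> p) (dominated_by p \<delta> s k)" if "k < p" for k
      using prob_dominated_by[OF \<mu> s(1) that \<delta> _ small] s(2) low
      by (simp add: field_simps)
    then show ?thesis by blast
  qed
  moreover have "eventually (\<lambda>p. \<eta> / H m0 < real p) sequentially"
    using filterlim_real_sequentially by (auto simp: filterlim_at_top_dense)
  ultimately have "eventually (\<lambda>p. \<exists>s. \<forall>k<p. (r * \<eta> / 4) / real p \<le> measure (alpha_spherical \<mu> p) (dominated_by p \<delta> s k)) sequentially"
    by (auto elim: eventually_mono)
  then show ?thesis using r \<eta> by (intro that[of "r * \<eta> / 4"]) auto
qed

section \<open>Convergence of the maximal inner product\<close>

theorem theorem3: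
  fixes \<alpha> :: real and \<mu> :: "real measure" and p :: "nat \<Rightarrow> nat"
    and M :: "nat \<Rightarrow> 'a measure" and X :: "nat \<Rightarrow> nat \<Rightarrow> 'a \<Rightarrow> (nat \<Rightarrow> real)"
  assumes "0 < \<alpha>" and "\<alpha> < 2"
    and "regularly_varying_law \<mu> \<alpha>"
    and "\<And>n. p n > 0"
    and "filterlim p at_top sequentially"
    and "(\<lambda>n. real (p n)) \<in> o(\<lambda>n. real n ^ 2)"
    and "\<And>n. normalizer_nonzero \<mu> (p n)"
    and "\<And>n. prob_space (M n)"
    and "\<And>n. prob_space.indep_vars (M n) (\<lambda>_. Rvec (p n)) (X n) {1..n}"
    and "\<And>n i. i \<in> {1..n} \<Longrightarrow> distr (M n) (Rvec (p n)) (X n i) = alpha_spherical \<mu> (p n)"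
  shows "tendsto_in_prob M
           (\<lambda>n \<omega>. Max {inner_vec (p n) (X n i \<omega>) (X n j \<omega>) | i j. 1 \<le> i \<and> i < j \<and> j \<le> n}) 1"
proof -
  define Z where "Z n \<omega> = Max {inner_vec (p n) (X n i \<omega>) (X n j \<omega>) | i j. 1 \<le> i \<and> i < j \<and> j \<le> n}" for n \<omega>
  define pairs where "pairs n = {ij :: nat \<times> nat. 1 \<le> fst ij \<and> fst ij < snd ij \<and> snd ij \<le> n}" for n
  have Zeq: "Z n \<omega> = Max ((\<lambda>ij. inner_vec (p n) (X n (fst ij) \<omega>) (X n (snd ij) \<omega>)) ` pairs n)" for n \<omega>
  proof -
    have "{inner_vec (p n) (X n i \<omega>) (X n j \<omega>) | i j. 1 \<le> i \<and> i < j \<and> j \<le> n} =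
      (\<lambda>(i, j). inner_vec (p n) (X n i \<omega>) (X n j \<omega>)) ` pairs n"
      by (force simp: pairs_def image_iff)
    then show ?thesis by (simp add: Z_def case_prod_unfold)
  qed
  have finp: "finite (pairs n)" for n
    by (rule finite_subset[of _ "{..n} \<times> {..n}"]) (auto simp: pairs_def)
  have X: "X n i \<in> measurable (M n) (Rvec (p n))" if "i \<in> {1..n}" for n i
    using assms(9)[of n] that by (simp add: prob_space.indep_vars_def[OF assms(8)])
  have Xk: "(\<lambda>\<omega>. X n i \<omega> k) \<in> borel_measurable (M n)" if "i \<in> {1..n}" "k < p n" for n i k
    using that by (intro measurable_compose[OF X measurable_component_singleton]) auto
  have Zmeas: "Z n \<in> borel_measurable (M n)" for n
    unfolding Zeq [abs_def] inner_vec_def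
    by (intro borel_measurable_Max finp borel_measurable_sum borel_measurable_times Xk)
       (auto simp: pairs_def)
  have \<mu>: "real_distribution \<mu>" using assms(3) by (simp add: regularly_varying_law_def)
  have unit: "AE \<omega> in M n. (\<Sum>k<p n. (X n i \<omega> k)\<^sup>2) = 1" if "i \<in> {1..n}" for n i
  proof -
    have "AE y in alpha_spherical \<mu> (p n). sqrt (\<Sum>k<p n. (y k)\<^sup>2) = 1"
      using AE_alpha_spherical_unit_norm[OF \<mu>] assms(7) by blast
    then have "AE y in distr (M n) (Rvec (p n)) (X n i). sqrt (\<Sum>k<p n. (y k)\<^sup>2) = 1"
      unfolding assms(10)[OF that] .
    from AE_distrD[OF X[OF that] this] show ?thesis by simp
  qed
  have "(\<lambda>n. measure (M n) {\<omega> \<in> space (M n). \<bar>Z n \<omega> - 1\<bar> > \<epsilon>}) \<longlonglongrightarrow> 0" if "\<epsilon> > 0" for \<epsilon>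
  proof -
    define \<delta> where "\<delta> = min (\<epsilon> / 2) (1 / 4)"
    have \<delta>: "0 < \<delta>" "\<delta> < 1/2" "\<delta> < 1" "2 * \<delta> \<le> \<epsilon>" using that by (auto simp: \<delta>_def)
    obtain c where c: "0 < c" and ev: "eventually (\<lambda>p. \<exists>s. \<forall>k<p. c / real p \<le>
        measure (alpha_spherical \<mu> p) (dominated_by p \<delta> s k)) sequentially"
      using prob_dominated_by_lower_bound[OF assms(3) \<delta>(1,3)] by blast
    \<comment> \<open>A lower bound for the expected number of coincidences between the two halves of the sample.\<close>
    define L where "L n = (real (n div 2))\<^sup>2 * (c\<^sup>2 / real (p n))" for n
    have bound: "measure (M n) {\<omega> \<in> space (M n). \<bar>Z n \<omega> - 1\<bar> > \<epsilon>} \<le> 2 / sqrt (L n) + 1 / L n"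
      if n: "2 \<le> n" and s: "\<forall>k<p n. c / real (p n) \<le> measure (alpha_spherical \<mu> (p n)) (dominated_by (p n) \<delta> s k)" for n s
    proof -
      interpret prob_space "M n" by (rule assms)
      define m where "m = n div 2"
      define I where "I = {1..m}"
      define J where "J = {Suc m..2 * m}"
      define A where "A = dominated_by (p n) \<delta> s"
      define q where "q k = measure (alpha_spherical \<mu> (p n)) (A k)" for k
      define lam where "lam = (real m)\<^sup>2 * (\<Sum>k<p n. (q k)\<^sup>2)"
      have IJ: "I \<union> J \<subseteq> {1..n}" "I \<inter> J = {}" "finite I" "finite J" "card I = m" "card J = m"
        by (auto simp: I_def J_def m_def)
      have IJlt: "i < j" if "i \<in> I" "j \<in> J" for i j using that by (auto simp: I_def J_def)
      have q: "prob {\<omega> \<in> space (M n). X n i \<omega> \<in> A k} = q k" if "i \<in> I \<union> J" "k \<in> {..<p n}" for i k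
      proof -
        have i: "i \<in> {1..n}" using that IJ by auto
        have "q k = measure (distr (M n) (Rvec (p n)) (X n i)) (A k)"
          using assms(10)[OF i] by (simp add: q_def)
        also have "\<dots> = prob (X n i -` A k \<inter> space (M n))"
          using that X[OF i] by (intro measure_distr) (auto simp: A_def sets_dominated_by)
        also have "X n i -` A k \<inter> space (M n) = {\<omega> \<in> space (M n). X n i \<omega> \<in> A k}" by auto
        finally show ?thesis by simp
      qed
      have pn: "0 < real (p n)" using assms(4) by simp
      have Lpos: "0 < L n" using n c pn by (auto simp: L_def intro!: mult_pos_pos divide_pos_pos)
      have Llam: "L n \<le> lam"
      proof -
        have "c\<^sup>2 / real (p n) = (\<Sum>k<p n. (c / real (p n))\<^sup>2)"
          using pn by (simp add: power2_eq_square)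
        also have "\<dots> \<le> (\<Sum>k<p n. (q k)\<^sup>2)"
          using s c by (intro sum_mono power_mono) (auto simp: q_def A_def)
        finally show ?thesis unfolding L_def lam_def m_def by (intro mult_left_mono) auto
      qed
      define none where "none = {\<omega> \<in> space (M n). \<forall>i\<in>I. \<forall>j\<in>J. \<forall>k\<in>{..<p n}. \<not> (X n i \<omega> \<in> A k \<and> X n j \<omega> \<in> A k)}"
      have "prob none \<le> 2 / sqrt lam + 1 / lam"
        unfolding none_def
      proof (rule birthday_collision_bound)
        show "indep_vars (\<lambda>_. Rvec (p n)) (X n) (I \<union> J)"
          using assms(9) IJ(1) by (rule indep_vars_subset)
        show "disjoint_family_on A {..<p n}" unfolding A_def by (rule disjoint_dominated_by) fact
        show "0 < lam" using Lpos Llam by linarith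
      qed (use IJ q lam_def in \<open>auto simp: A_def sets_dominated_by\<close>)
      also have "\<dots> \<le> 2 / sqrt (L n) + 1 / L n"
        using Lpos Llam by (intro add_mono divide_left_mono mult_pos_pos) auto
      finally have none: "prob none \<le> 2 / sqrt (L n) + 1 / L n" .
      have none_sets: "none \<in> events"
      proof -
        have [measurable]: "X n i \<in> measurable (M n) (Rvec (p n))" if "i \<in> I \<union> J" for i
          using that IJ X by auto
        have [measurable]: "A k \<in> sets (Rvec (p n))" if "k \<in> {..<p n}" for k
          using that by (simp add: A_def sets_dominated_by)
        have "{\<omega> \<in> space (M n). \<not> (X n i \<omega> \<in> A k \<and> X n j \<omega> \<in> A k)} \<in> events"
          if [simp]: "i \<in> I" "j \<in> J" "k \<in> {..<p n}" for i j k
          using that by measurable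
        then show ?thesis unfolding none_def using IJ
          by (intro sets.sets_Collect_finite_All) auto
      qed
      \<comment> \<open>Unit length bounds the maximum by 1, so only the lower deviation needs a coincidence.\<close>
      have "AE \<omega> in M n. \<forall>i\<in>{1..n}. (\<Sum>k<p n. (X n i \<omega> k)\<^sup>2) = 1"
        using unit by (intro AE_finite_allI) auto
      then have "AE \<omega> in M n. \<omega> \<in> {\<omega> \<in> space (M n). \<bar>Z n \<omega> - 1\<bar> > \<epsilon>} \<longrightarrow> \<omega> \<in> none"
      proof eventually_elim
        case (elim \<omega>)
        have ne: "pairs n \<noteq> {}"
        proof -
          have "(1, 2) \<in> pairs n" using n by (simp add: pairs_def)
          then show ?thesis by blast
        qed
        have up: "Z n \<omega> \<le> 1"
          unfolding Zeq using ne finp elim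
          by (subst Max_le_iff) (auto simp: pairs_def intro!: inner_vec_le_1)
        show ?case
        proof (rule impI, rule ccontr)
          assume dev: "\<omega> \<in> {\<omega> \<in> space (M n). \<bar>Z n \<omega> - 1\<bar> > \<epsilon>}" and "\<omega> \<notin> none"
          then obtain i j k where ijk: "i \<in> I" "j \<in> J" "k < p n" "X n i \<omega> \<in> A k" "X n j \<omega> \<in> A k"
            by (auto simp: none_def)
          have "(i, j) \<in> pairs n" using IJlt[OF ijk(1,2)] IJ(1) ijk by (auto simp: pairs_def)
          then have "inner_vec (p n) (X n i \<omega>) (X n j \<omega>) \<le> Z n \<omega>"
            unfolding Zeq using finp by (intro Max_ge) force+
          moreover have "1 - 2 * \<delta> \<le> inner_vec (p n) (X n i \<omega>) (X n j \<omega>)"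
            using ijk \<delta> unfolding A_def by (intro inner_vec_dominated_by) auto
          ultimately have "1 - \<epsilon> \<le> Z n \<omega>" using \<delta> by linarith
          then show False using dev up by auto
        qed
      qed
      then have "measure (M n) {\<omega> \<in> space (M n). \<bar>Z n \<omega> - 1\<bar> > \<epsilon>} \<le> prob none"
        using none_sets by (rule finite_measure_mono_AE)
      then show ?thesis using none by linarith
    qed
    have Llim: "filterlim L at_top sequentially"
    proof -
      have small: "(\<lambda>n. real (p n) / real n ^ 2) \<longlonglongrightarrow> 0" using assms(6) by (rule smalloD_tendsto)
      have pos: "eventually (\<lambda>n. 0 < real (p n) / real n ^ 2) sequentially"
        using eventually_gt_at_top[of 0] by eventually_elim (use assms(4) in auto)
      have inv: "filterlim (\<lambda>n. inverse (real (p n) / real n ^ 2)) at_top sequentially"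
        using small pos by (rule filterlim_inverse_at_top)
      have half: "(\<lambda>n. c\<^sup>2 * (real (n div 2) / real n)\<^sup>2) \<longlonglongrightarrow> c\<^sup>2 * (1/2)\<^sup>2"
      proof -
        have "(\<lambda>n. real (n div 2) / real n) \<longlonglongrightarrow> 1/2"
          by real_asymp
        from tendsto_mult[OF tendsto_const tendsto_power[OF this]] show ?thesis .
      qed
      have "filterlim (\<lambda>n. c\<^sup>2 * (real (n div 2) / real n)\<^sup>2 * inverse (real (p n) / real n ^ 2)) at_top sequentially"
        by (rule filterlim_tendsto_pos_mult_at_top[OF half _ inv]) (use c in auto)
      then show ?thesis
        by (rule filterlim_mono_eventually)
           (auto simp: L_def field_simps intro!: eventually_mono[OF eventually_gt_at_top[of 0]])
    qed
    have "((\<lambda>x. 2 / sqrt x + 1 / x) \<longlongrightarrow> 0) at_top" by real_asymp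
    from filterlim_compose[OF this Llim] have lim0: "(\<lambda>n. 2 / sqrt (L n) + 1 / L n) \<longlonglongrightarrow> 0" .
    have "eventually (\<lambda>n. measure (M n) {\<omega> \<in> space (M n). \<bar>Z n \<omega> - 1\<bar> > \<epsilon>} \<le> 2 / sqrt (L n) + 1 / L n) sequentially"
      using eventually_ge_at_top[of 2] eventually_compose_filterlim[OF ev assms(5)]
      by eventually_elim (use bound in blast)
    then show ?thesis
      by (intro tendsto_sandwich[OF _ _ tendsto_const lim0]) auto
  qed
  then show ?thesis using Zmeas unfolding tendsto_in_prob_def Z_def [abs_def] by blast
qed

end
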